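(* Let $G$ be a finite group whose order $|G|$ is squarefree, and let $k(G)$ be the number of conjugacy classes of $G$. Then $|G| \leq k(G)^3$.
   Context: A positive integer is squarefree if it is not divisible by the square of any prime (so $1$ is squarefree). *)

theory Defs
  imports "HOL-Algebra.Group_Action" "HOL-Computational_Algebra.Squarefree"
begin

definition conj_classes :: "('a, 'b) monoid_scheme \<Rightarrow> 'a set set" where
  "conj_classes G =
     orbits G (carrier G) (\<lambda>g. \<lambda>h \<in> carrier G. g \<otimes>\<^bsub>G\<^esub> h \<otimes>\<^bsub>G\<^esub> inv\<^bsub>G\<^esub> g)"

definition num_conj_classes :: "('a, 'b) monoid_scheme \<Rightarrow> nat" where
  "num_conj_classes G = card (conj_classes G)"

lemma conj_classes_altdef:
  "conj_classes G =
     {{g \<otimes>\<^bsub>G\<^esub> x \<otimes>\<^bsub>G\<^esub> inv\<^bsub>G\<^esub> g | g. g \<in> carrier G} | x. x \<in> carrier G}"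
  unfolding conj_classes_def orbits_def orbit_def by (auto simp: restrict_def)

text \<open>The library defines squarefreeness of a natural number through non-units; it agrees with
  the usual definition through squares of primes.\<close>

lemma squarefree_nat_iff_prime:
  fixes n :: nat
  shows "squarefree n \<longleftrightarrow> n > 0 \<and> (\<forall>p. prime p \<longrightarrow> \<not> p\<^sup>2 dvd n)"
proof (intro iffI conjI allI impI notI)
  assume "squarefree n"
  then show "n > 0" by (cases "n = 0") auto
next
  fix p :: nat assume "squarefree n" "prime p" "p\<^sup>2 dvd n"
  then show False by (auto simp: squarefree_def)
next
  assume n: "n > 0 \<and> (\<forall>p. prime p \<longrightarrow> \<not> p\<^sup>2 dvd n)"
  show "squarefree n"
  proof (rule squarefreeI)
    fix x assume x: "x\<^sup>2 dvd n"
    show "x dvd 1"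
    proof (rule ccontr)
      assume "\<not> x dvd 1"
      then obtain p where "prime p" "p dvd x" using prime_factor_nat[of x] by auto
      then have "p\<^sup>2 dvd n" using x by (meson dvd_power_same dvd_trans)
      with n \<open>prime p\<close> show False by blast
    qed
  qed
qed

end

theory Submission
  imports Defs "HOL-Number_Theory.Cong" "HOL-Algebra.Sylow" "HOL-Algebra.Multiplicative_Group"
    "HOL-Algebra.Generated_Groups"
begin

text \<open>
  A group of squarefree order is metabelian. By counting solutions of \<open>x\<^sup>a = 1\<close> (Frobenius), the Sylow
  subgroup \<open>Q\<close> for the largest prime divisor is normal. By induction \<open>G / Q\<close> is metabelian;
  commutators centralize \<open>Q\<close> because automorphisms of a group of prime order commute, so
  \<open>c = [a, b] \<in> Q\<close>, for commutators \<open>a\<close> and \<open>b\<close>, satisfies \<open>c\<^sup>n = 1\<close> with \<open>n = |G / Q|\<close> coprime to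
  \<open>|Q|\<close>, whence \<open>c = 1\<close>.

  If \<open>D\<close> is the derived subgroup of a metabelian group and \<open>n = |G : D|\<close>, then \<open>n \<le> k(G)\<close>, because
  every class lies in a single coset of \<open>D\<close>; and classes of elements of the abelian subgroup \<open>D\<close>
  have at most \<open>n\<close> elements, so \<open>|D| \<le> k(G) n\<close>. Hence \<open>|G| = n |D| \<le> k(G) n\<^sup>2 \<le> k(G)\<^sup>3\<close>.
\<close>

section \<open>Powers, conjugation and elements of prime order\<close>

lemma (in group) pow_cong:
  fixes i j n :: nat
  assumes x: "x \<in> carrier G" and "x [^] n = \<one>" and "[i = j] (mod n)"
  shows "x [^] i = x [^] j"
proof -
  have "x [^] k = x [^] (k mod n)" for k
  proof -
    have "x [^] k = x [^] (n * (k div n) + k mod n)" by simp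
    also have "\<dots> = (x [^] n) [^] (k div n) \<otimes> x [^] (k mod n)"
      using x by (simp only: nat_pow_mult nat_pow_pow nat_pow_closed)
    finally show ?thesis using assms by simp
  qed
  then show ?thesis using assms(3) unfolding cong_def by metis
qed

lemma (in group) conj_mult:
  assumes "g \<in> carrier G" "x \<in> carrier G" "y \<in> carrier G"
  shows "(g \<otimes> x \<otimes> inv g) \<otimes> (g \<otimes> y \<otimes> inv g) = g \<otimes> (x \<otimes> y) \<otimes> inv g"
proof -
  have "inv g \<otimes> (g \<otimes> (y \<otimes> inv g)) = y \<otimes> inv g"
    using assms by (simp flip: m_assoc)
  then show ?thesis using assms by (simp add: m_assoc)
qed

lemma (in group) conj_pow:
  fixes n :: nat
  assumes "g \<in> carrier G" "x \<in> carrier G"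
  shows "(g \<otimes> x \<otimes> inv g) [^] n = g \<otimes> x [^] n \<otimes> inv g"
  by (induction n) (use assms in \<open>simp_all add: conj_mult\<close>)

lemma (in group) conj_conj_inv:
  assumes "g \<in> carrier G" "x \<in> carrier G"
  shows "inv g \<otimes> (g \<otimes> x \<otimes> inv g) \<otimes> g = x"
  using assms by (simp add: m_assoc) (simp flip: m_assoc)

lemma (in group) conj_eq_iff_commute:
  assumes "g \<in> carrier G" "x \<in> carrier G"
  shows "g \<otimes> x \<otimes> inv g = x \<longleftrightarrow> g \<otimes> x = x \<otimes> g"
  using assms by (metis inv_solve_right m_closed)

lemma (in group) inv_comm_commute:
  assumes "x \<in> carrier G" "g \<in> carrier G" "g \<otimes> x = x \<otimes> g"
  shows "g \<otimes> inv x = inv x \<otimes> g"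
proof -
  have "inv x \<otimes> g = inv x \<otimes> (g \<otimes> x) \<otimes> inv x" using assms(1,2) by (simp add: m_assoc)
  also have "\<dots> = inv x \<otimes> (x \<otimes> g) \<otimes> inv x" using assms(3) by simp
  also have "\<dots> = g \<otimes> inv x" using assms(1,2) by (simp flip: m_assoc)
  finally show ?thesis by simp
qed

lemma (in group) pow_card_subgroup_eq_one:
  assumes H: "subgroup H G" and x: "x \<in> H"
  shows "x [^] card H = \<one>"
proof -
  have "x [^]\<^bsub>G\<lparr>carrier := H\<rparr>\<^esub> order (G\<lparr>carrier := H\<rparr>) = \<one>"
    using group.pow_order_eq_1[OF subgroup.subgroup_is_group[OF H is_group], of x] x by simp
  then show ?thesis by (simp add: order_def flip: nat_pow_consistent)
qed

lemma (in group) cauchy: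
  assumes "finite (carrier G)" "prime p" "p dvd order G"
  obtains x where "x \<in> carrier G" "x \<noteq> \<one>" "x [^] p = \<one>"
proof -
  \<comment> \<open>\<open>sylow_thm\<close> covers every power of \<open>p\<close> dividing the
    order, so exponent 1 gives a subgroup of order \<open>p\<close>, whatever power of
    \<open>p\<close> is left in \<open>m\<close>.\<close>
  from assms(3) obtain m where "order G = p ^ 1 * m" by auto
  then obtain H where H: "subgroup H G" "card H = p"
    using sylow_thm[OF assms(2) is_group _ assms(1), of 1 m] by auto
  have "finite H" using H assms(2) by (metis card.infinite not_prime_0)
  moreover have "card H > 1" using H prime_gt_1_nat[OF assms(2)] by simp
  ultimately have "\<not> H \<subseteq> {\<one>}" using card_mono[of "{\<one>}" H] by auto
  then obtain x where x: "x \<in> H" "x \<noteq> \<one>" by blast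
  have "x [^] p = \<one>" using pow_card_subgroup_eq_one[OF H(1) x(1)] H(2) by simp
  then show ?thesis using that x subgroup.mem_carrier[OF H(1)] by blast
qed

section \<open>Counting solutions of \<open>x [^] a = \<one>\<close>\<close>

text \<open>By the Chinese remainder theorem there are exponents \<open>e\<close> and
  \<open>f\<close> that project onto the two coprime parts: each root \<open>x\<close> is uniquely a
  product of commuting elements \<open>x [^] e\<close> and \<open>x [^] f\<close>, with orders
  dividing \<open>a\<close> and \<open>b\<close>. The sum counts these pairs by their first
  entry.\<close>

lemma (in group) card_roots_coprime_mult:
  fixes a b :: nat
  assumes fin: "finite (carrier G)" and ab: "coprime a b"
  shows "card {x \<in> carrier G. x [^] (a * b) = \<one>} =
    (\<Sum>u | u \<in> carrier G \<and> u [^] a = \<one>. card {v \<in> carrier G. v [^] b = \<one> \<and> u \<otimes> v = v \<otimes> u})"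
proof -
  obtain e where e: "[e = 1] (mod a)" "[e = 0] (mod b)"
    using binary_chinese_remainder_nat[OF ab] by blast
  obtain f where f: "[f = 0] (mod a)" "[f = 1] (mod b)"
    using binary_chinese_remainder_nat[OF ab] by blast
  have "[e + f = 1 + 0] (mod a)" "[e + f = 0 + 1] (mod b)"
    using e f by (metis cong_add)+
  then have ef: "[e + f = 1] (mod (a * b))"
    using coprime_cong_mult_nat[OF _ _ ab] by simp
  let ?S = "SIGMA u:{u \<in> carrier G. u [^] a = \<one>}. {v \<in> carrier G. v [^] b = \<one> \<and> u \<otimes> v = v \<otimes> u}"
  have "bij_betw (\<lambda>(u,v). u \<otimes> v) ?S {x \<in> carrier G. x [^] (a * b) = \<one>}"
  proof (rule bij_betw_byWitness[where f' = "\<lambda>x. (x [^] e, x [^] f)"], safe)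
    fix u v assume u: "u \<in> carrier G" "u [^] a = \<one>" and v: "v \<in> carrier G" "v [^] b = \<one>"
      and uv: "u \<otimes> v = v \<otimes> u"
    have "u [^] e = u" "u [^] f = \<one>" "v [^] e = \<one>" "v [^] f = v"
      using pow_cong[OF u e(1)] pow_cong[OF u f(1)] pow_cong[OF v e(2)] pow_cong[OF v f(2)] u v by auto
    then show "(u \<otimes> v) [^] e = u" "(u \<otimes> v) [^] f = v"
      using pow_mult_distrib[OF uv u(1) v(1)] u v by auto
    have "u [^] (a * b) = \<one>" "v [^] (a * b) = \<one>"
      using u v by (metis nat_pow_pow nat_pow_one, metis nat_pow_pow nat_pow_one mult.commute)
    then show "(u \<otimes> v) [^] (a * b) = \<one>"
      using pow_mult_distrib[OF uv u(1) v(1)] u v by auto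
    show "u \<otimes> v \<in> carrier G" using u v by simp
  next
    fix x assume x: "x \<in> carrier G" "x [^] (a * b) = \<one>"
    show "x [^] e \<otimes> x [^] f = x" using pow_cong[OF x ef] x by (simp add: nat_pow_mult)
    show "x [^] e \<in> carrier G" "x [^] f \<in> carrier G" using x by auto
    show "x [^] e \<otimes> x [^] f = x [^] f \<otimes> x [^] e" using x(1) by (rule nat_pow_comm)
    have "b dvd e" "a dvd f" using e f by (simp_all add: cong_0_iff)
    then have "a * b dvd e * a" "a * b dvd f * b" by (simp_all add: mult.commute)
    then show "(x [^] e) [^] a = \<one>" "(x [^] f) [^] b = \<one>"
      using x by (metis nat_pow_pow nat_pow_one dvdE)+
  qed
  then have "card {x \<in> carrier G. x [^] (a * b) = \<one>} = card ?S" by (simp add: bij_betw_same_card)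
  then show ?thesis using fin by simp
qed

text \<open>\<open>N\<close> is a disjoint union of orbits and \<open>f\<close> is constant on each,
  so one orbit contributes \<open>card (orbit G \<phi> u) * f u\<close>. This handles the noncentral
  elements in Frobenius' theorem.\<close>

lemma (in group_action) dvd_sum_orbits:
  fixes f :: "'c \<Rightarrow> nat"
  assumes "finite E" "N \<subseteq> E"
    and orb: "\<And>u. u \<in> N \<Longrightarrow> orbit G \<phi> u \<subseteq> N"
    and const: "\<And>u v. u \<in> N \<Longrightarrow> v \<in> orbit G \<phi> u \<Longrightarrow> f v = f u"
    and dvd: "\<And>u. u \<in> N \<Longrightarrow> d dvd card (orbit G \<phi> u) * f u"
  shows "d dvd sum f N"
proof -
  have N: "N = \<Union> (orbit G \<phi> ` N)" using orb orbit_refl assms(2) by blast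
  have fin: "finite N" using assms finite_subset by blast
  have "A \<inter> B = {}" if AB: "A \<in> orbit G \<phi> ` N" "B \<in> orbit G \<phi> ` N" "A \<noteq> B" for A B
  proof (rule ccontr)
    assume "A \<inter> B \<noteq> {}"
    then obtain z where z: "z \<in> A" "z \<in> B" by blast
    obtain u v where uv: "u \<in> N" "v \<in> N" "A = orbit G \<phi> u" "B = orbit G \<phi> v" using AB by auto
    have E: "orbit G \<phi> w \<subseteq> E" if "w \<in> N" for w using orb[OF that] assms(2) by blast
    have sub: "orbit G \<phi> u' \<subseteq> orbit G \<phi> v'"
      if "u' \<in> N" "v' \<in> N" "z \<in> orbit G \<phi> u'" "z \<in> orbit G \<phi> v'" for u' v'
    proof
      fix w assume w: "w \<in> orbit G \<phi> u'"
      have mem: "u' \<in> E" "v' \<in> E" "z \<in> E" "w \<in> E"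
        using that w E assms(2) by auto
      have "u' \<in> orbit G \<phi> z" using orbit_sym mem that by blast
      then have "u' \<in> orbit G \<phi> v'" using orbit_trans[of v' z u'] mem that by blast
      then show "w \<in> orbit G \<phi> v'" using orbit_trans[of v' u' w] mem w by blast
    qed
    then have "A = B" using uv z by (intro subset_antisym) auto
    then show False using AB by simp
  qed
  then have "sum f (\<Union> (orbit G \<phi> ` N)) = sum (sum f) (orbit G \<phi> ` N)"
    using fin finite_subset[OF orb] by (subst sum.Union_disjoint) auto
  moreover have "d dvd sum f (orbit G \<phi> u)" if "u \<in> N" for u
    using dvd[OF that] const[OF that] by simp
  ultimately show ?thesis using N by (metis (no_types, lifting) dvd_sum imageE)
qed

text \<open>Frobenius' theorem for Hall divisors. Each element factors uniquely as \<open>u v = v u\<close> with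
  \<open>u\<^sup>b = 1\<close> and \<open>v\<^sup>a = 1\<close>. The non-central \<open>u\<close> contribute a multiple of \<open>d = gcd a |G|\<close> by induction on
  their centralizers, and the number of central \<open>u\<close> is coprime to \<open>d\<close>.\<close>

lemma frobenius_roots:
  fixes a b :: nat and G :: "('a, 'b) monoid_scheme"
  assumes "coprime a b"
  shows "\<lbrakk>group G; finite (carrier G); order G dvd a * b\<rbrakk> \<Longrightarrow>
    gcd a (order G) dvd card {x \<in> carrier G. x [^]\<^bsub>G\<^esub> a = \<one>\<^bsub>G\<^esub>}"
proof (induction "order G" arbitrary: G rule: less_induct)
  case less
  interpret group G by fact
  note fin = \<open>finite (carrier G)\<close>
  define \<phi> where "\<phi> = (\<lambda>g. \<lambda>h \<in> carrier G. g \<otimes>\<^bsub>G\<^esub> h \<otimes>\<^bsub>G\<^esub> inv\<^bsub>G\<^esub> g)"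
  interpret conj: group_action G "carrier G" \<phi>
    unfolding \<phi>_def by (rule action_by_conjugation)
  have \<phi>: "\<phi> g x = g \<otimes>\<^bsub>G\<^esub> x \<otimes>\<^bsub>G\<^esub> inv\<^bsub>G\<^esub> g" if "x \<in> carrier G" for g x
    using that by (simp add: \<phi>_def)
  define d where "d = gcd a (order G)"
  define V where "V u = {v \<in> carrier G. v [^]\<^bsub>G\<^esub> a = \<one>\<^bsub>G\<^esub> \<and> u \<otimes>\<^bsub>G\<^esub> v = v \<otimes>\<^bsub>G\<^esub> u}" for u
  define f where "f u = card (V u)" for u
  define U where "U = {u \<in> carrier G. u [^]\<^bsub>G\<^esub> b = \<one>\<^bsub>G\<^esub>}"
  define C where "C = {u \<in> U. \<forall>g\<in>carrier G. g \<otimes>\<^bsub>G\<^esub> u = u \<otimes>\<^bsub>G\<^esub> g}"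
  have finU: "finite U" using fin by (simp add: U_def)
  \<comment> \<open>Every element is a root for \<open>b * a\<close>, so the factorization count
    covers the whole group. On \<open>C\<close> the summand is the wanted number of roots itself,
    which isolates it.\<close>
  have "x [^]\<^bsub>G\<^esub> (b * a) = \<one>\<^bsub>G\<^esub>" if "x \<in> carrier G" for x
    using that less(4) ord_dvd_group_order[OF that] dvd_trans by (auto simp: pow_eq_id mult.commute)
  then have "{x \<in> carrier G. x [^]\<^bsub>G\<^esub> (b * a) = \<one>\<^bsub>G\<^esub>} = carrier G" by blast
  then have "order G = sum f U"
    using card_roots_coprime_mult[OF fin, of b a] assms
    by (simp add: coprime_commute order_def U_def f_def V_def)
  also have "\<dots> = sum f C + sum f (U - C)"
    using finU sum.subset_diff[of C U f] by (auto simp: C_def)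
  also have "sum f C = card C * card {x \<in> carrier G. x [^]\<^bsub>G\<^esub> a = \<one>\<^bsub>G\<^esub>}"
  proof -
    have "V u = {x \<in> carrier G. x [^]\<^bsub>G\<^esub> a = \<one>\<^bsub>G\<^esub>}" if "u \<in> C" for u
      using that unfolding V_def C_def by auto
    then show ?thesis by (simp add: f_def)
  qed
  finally have sum: "order G = card C * card {x \<in> carrier G. x [^]\<^bsub>G\<^esub> a = \<one>\<^bsub>G\<^esub>} + sum f (U - C)" .
  have "d dvd sum f (U - C)"
  proof (rule conj.dvd_sum_orbits[OF fin])
    show "U - C \<subseteq> carrier G" by (auto simp: U_def)
    \<comment> \<open>One inequality is enough: a conjugator taking \<open>v\<close> back to
      \<open>u\<close> gives the reverse one.\<close>
    have le: "f u \<le> f (\<phi> g u)" if "g \<in> carrier G" "u \<in> carrier G" for g u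
      unfolding f_def
    proof (rule card_inj_on_le)
      show "inj_on (\<phi> g) (V u)"
        by (rule inj_on_subset[OF conj.inj_prop[OF that(1)]]) (auto simp: V_def)
      show "\<phi> g ` V u \<subseteq> V (\<phi> g u)"
        using that by (auto simp: V_def \<phi> conj_pow conj_mult)
      show "finite (V (\<phi> g u))" using fin by (simp add: V_def)
    qed
    show orb: "orbit G \<phi> u \<subseteq> U - C" if "u \<in> U - C" for u
    proof
      have u: "u \<in> carrier G" "u [^]\<^bsub>G\<^esub> b = \<one>\<^bsub>G\<^esub>" using that by (auto simp: U_def)
      fix v assume "v \<in> orbit G \<phi> u"
      then obtain g where g: "g \<in> carrier G" "v = g \<otimes>\<^bsub>G\<^esub> u \<otimes>\<^bsub>G\<^esub> inv\<^bsub>G\<^esub> g"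
        using \<phi>[OF u(1)] by (auto simp: orbit_def)
      have v: "v \<in> U" using g u by (simp add: U_def conj_pow)
      moreover have "v \<notin> C"
      proof
        assume "v \<in> C"
        then have "inv\<^bsub>G\<^esub> g \<otimes>\<^bsub>G\<^esub> v = v \<otimes>\<^bsub>G\<^esub> inv\<^bsub>G\<^esub> g" using g by (simp add: C_def)
        moreover have "inv\<^bsub>G\<^esub> g \<otimes>\<^bsub>G\<^esub> v \<otimes>\<^bsub>G\<^esub> g = u" using conj_conj_inv g u by simp
        ultimately have "v = u" using g u by (simp add: m_assoc)
        then show False using \<open>v \<in> C\<close> that by simp
      qed
      ultimately show "v \<in> U - C" by simp
    qed
    show "f v = f u" if "u \<in> U - C" "v \<in> orbit G \<phi> u" for u v
    proof -
      have u: "u \<in> carrier G" and v: "v \<in> carrier G"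
        using orb[OF that(1)] that by (auto simp: U_def)
      have "u \<in> orbit G \<phi> v" using conj.orbit_sym[OF u v that(2)] .
      with that(2) obtain g h where "g \<in> carrier G" "v = \<phi> g u" "h \<in> carrier G" "u = \<phi> h v"
        unfolding orbit_def by blast
      then show ?thesis using le[of g u] le[of h v] u v by simp
    qed
    show "d dvd card (orbit G \<phi> u) * f u" if "u \<in> U - C" for u
    proof -
      have u: "u \<in> carrier G" using that by (auto simp: U_def)
      let ?S = "stabilizer G \<phi> u"
      let ?H = "G\<lparr>carrier := ?S\<rparr>"
      have S: "?S = {g \<in> carrier G. g \<otimes>\<^bsub>G\<^esub> u = u \<otimes>\<^bsub>G\<^esub> g}"
        unfolding stabilizer_def using conj_eq_iff_commute[OF _ u] \<phi>[OF u] by auto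
      have sub: "subgroup ?S G" using conj.stabilizer_subgroup[OF u] .
      \<comment> \<open>As \<open>u\<close> is not central, its centralizer is proper and the
        induction hypothesis applies to it.\<close>
      have "?S \<subset> carrier G" using that by (auto simp: S C_def)
      then have "order ?H < order G" using fin by (simp add: order_def psubset_card_mono)
      moreover have "order ?H dvd order G"
        unfolding lagrange[OF sub, symmetric] by (simp add: order_def)
      moreover have "group ?H" using sub is_group by (rule subgroup.subgroup_is_group)
      moreover have "finite (carrier ?H)" using fin by (simp add: S)
      ultimately have "gcd a (order ?H) dvd card {x \<in> carrier ?H. x [^]\<^bsub>?H\<^esub> a = \<one>\<^bsub>?H\<^esub>}"
        using less(1)[of ?H] less(4) dvd_trans by blast
      moreover have "{x \<in> carrier ?H. x [^]\<^bsub>?H\<^esub> a = \<one>\<^bsub>?H\<^esub>} = V u"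
        by (auto simp: V_def S simp flip: nat_pow_consistent)
      ultimately have "gcd a (card ?S) dvd f u" by (simp add: f_def order_def)
      \<comment> \<open>By orbit-stabilizer the right side is the gcd of
        \<open>card (orbit G \<phi> u) * a\<close> and \<open>order G\<close>, and \<open>d\<close>
        divides both.\<close>
      moreover have "d dvd card (orbit G \<phi> u) * gcd a (card ?S)"
        unfolding gcd_mult_distrib_nat conj.orbit_stabilizer_theorem[OF u] d_def by simp
      ultimately show ?thesis by (meson dvd_trans mult_dvd_mono dvd_refl)
    qed
  qed
  then have dvd: "d dvd card C * card {x \<in> carrier G. x [^]\<^bsub>G\<^esub> a = \<one>\<^bsub>G\<^esub>}"
    using sum dvd_add_left_iff[of d] gcd_dvd2[of a "order G", folded d_def] by metis
  have subC: "subgroup C G"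
  proof (rule subgroupI)
    show "C \<subseteq> carrier G" by (auto simp: C_def U_def)
    have "\<one>\<^bsub>G\<^esub> \<in> C" by (simp add: C_def U_def)
    then show "C \<noteq> {}" by blast
    fix x assume x: "x \<in> C"
    then show "inv\<^bsub>G\<^esub> x \<in> C"
      using inv_comm_commute by (auto simp: C_def U_def nat_pow_inv)
    fix y assume y: "y \<in> C"
    have xy: "x \<in> carrier G" "y \<in> carrier G" "x [^]\<^bsub>G\<^esub> b = \<one>\<^bsub>G\<^esub>" "y [^]\<^bsub>G\<^esub> b = \<one>\<^bsub>G\<^esub>"
      and com: "\<And>g. g \<in> carrier G \<Longrightarrow> g \<otimes>\<^bsub>G\<^esub> x = x \<otimes>\<^bsub>G\<^esub> g" "\<And>g. g \<in> carrier G \<Longrightarrow> g \<otimes>\<^bsub>G\<^esub> y = y \<otimes>\<^bsub>G\<^esub> g"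
      using x y unfolding C_def U_def by blast+
    have "(x \<otimes>\<^bsub>G\<^esub> y) [^]\<^bsub>G\<^esub> b = \<one>\<^bsub>G\<^esub>"
      unfolding pow_mult_distrib[OF com(2)[OF xy(1)] xy(1,2)] using xy by simp
    moreover have "g \<otimes>\<^bsub>G\<^esub> (x \<otimes>\<^bsub>G\<^esub> y) = x \<otimes>\<^bsub>G\<^esub> y \<otimes>\<^bsub>G\<^esub> g" if "g \<in> carrier G" for g
    proof -
      have "g \<otimes>\<^bsub>G\<^esub> (x \<otimes>\<^bsub>G\<^esub> y) = (g \<otimes>\<^bsub>G\<^esub> x) \<otimes>\<^bsub>G\<^esub> y" using that xy by (simp add: m_assoc)
      also have "\<dots> = x \<otimes>\<^bsub>G\<^esub> (g \<otimes>\<^bsub>G\<^esub> y)" unfolding com(1)[OF that] using that xy by (simp add: m_assoc)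
      also have "\<dots> = x \<otimes>\<^bsub>G\<^esub> y \<otimes>\<^bsub>G\<^esub> g" unfolding com(2)[OF that] using that xy by (simp add: m_assoc)
      finally show ?thesis .
    qed
    ultimately show "x \<otimes>\<^bsub>G\<^esub> y \<in> C" using xy by (auto simp: C_def U_def)
  qed
  \<comment> \<open>For a common prime \<open>p\<close>, Cauchy in the subgroup \<open>C\<close>
    gives an element of order \<open>p\<close> whose \<open>b\<close>-th power is one; then
    \<open>p\<close> divides both \<open>a\<close> and \<open>b\<close>.\<close>
  have "coprime d (card C)"
  proof (rule ccontr)
    assume "\<not> coprime d (card C)"
    then obtain p where p: "prime p" "p dvd d" "p dvd card C"
      using prime_factor_nat[of "gcd d (card C)"] by (auto simp: coprime_iff_gcd_eq_1)
    interpret C: group "G\<lparr>carrier := C\<rparr>" using subC is_group by (rule subgroup.subgroup_is_group)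
    have "finite C" using finU by (simp add: C_def)
    then obtain x where "x \<in> C" "x \<noteq> \<one>\<^bsub>G\<^esub>" "x [^]\<^bsub>G\<^esub> p = \<one>\<^bsub>G\<^esub>"
      using C.cauchy[of p] p by (auto simp: order_def simp flip: nat_pow_consistent)
    then have "x \<in> carrier G" "ord x dvd p" "ord x dvd b" "x \<noteq> \<one>\<^bsub>G\<^esub>"
      by (auto simp: C_def U_def simp flip: pow_eq_id)
    then have "p dvd b" using p(1) ord_eq_1 by (metis prime_nat_iff)
    moreover have "p dvd a" using p by (simp add: d_def)
    ultimately show False using assms p(1) coprime_common_divisor[of a b p] by auto
  qed
  then show ?case using dvd by (simp add: d_def coprime_dvd_mult_right_iff)
qed

section \<open>Squarefree order: a normal subgroup of prime order\<close>

text \<open>Being a power of one another is an equivalence on \<open>W\<close>, and each class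
  consists of the \<open>p - 1\<close> generators of one subgroup of order \<open>p\<close>.\<close>

lemma (in group) dvd_card_prime_order_elements:
  assumes fin: "finite (carrier G)" and p: "prime p" and W: "W \<subseteq> carrier G"
    and root: "\<And>x. x \<in> W \<Longrightarrow> x [^] p = \<one> \<and> x \<noteq> \<one>"
    and closed: "\<And>x (j::nat). x \<in> W \<Longrightarrow> x [^] j \<noteq> \<one> \<Longrightarrow> x [^] j \<in> W"
  shows "p - 1 dvd card W"
proof -
  have ord: "ord x = p" if "x \<in> W" for x
    using that root W p ord_eq_1 pow_eq_id by (metis prime_nat_iff subsetD)
  define r where "r = {(x, y). x \<in> W \<and> y \<in> W \<and> (\<exists>j::nat. y = x [^] j)}"
  have "equiv W r"
  proof (rule equivI)
    show "refl_on W r" unfolding refl_on_def r_def using W nat_pow_eone by (auto intro!: exI[of _ 1])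
    show "r \<subseteq> W \<times> W" by (auto simp: r_def)
    show "sym r"
    proof (rule symI)
      fix x y assume "(x, y) \<in> r"
      then obtain j :: nat where xy: "x \<in> W" "y \<in> W" "y = x [^] j" by (auto simp: r_def)
      have x: "x \<in> carrier G" using xy W by blast
      \<comment> \<open>Since \<open>y\<close> is nontrivial, \<open>j\<close> is invertible modulo
        \<open>p\<close>, and the inverse exponent recovers \<open>x\<close>.\<close>
      have "\<not> p dvd j" using root[OF xy(2)] xy ord[OF xy(1)] pow_eq_id[OF x] by auto
      then have "coprime j p" using p by (metis coprime_commute prime_imp_coprime)
      then obtain i where "[j * i = 1] (mod p)" using cong_solve_coprime_nat by auto
      then have "x [^] (j * i) = x [^] (1::nat)" using pow_cong x root[OF xy(1)] by blast
      then have "y [^] i = x" using x xy by (simp add: nat_pow_pow)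
      then show "(y, x) \<in> r" using xy unfolding r_def by blast
    qed
    show "trans r"
      using W by (auto simp: trans_def r_def) (metis nat_pow_pow subsetD)
  qed
  moreover have "p - 1 dvd card X" if "X \<in> W // r" for X
  proof -
    from that obtain x where x: "x \<in> W" "X = r `` {x}" by (auto simp: quotient_def)
    have xc: "x \<in> carrier G" using x W by blast
    have ne: "x [^] j \<noteq> \<one>" if "j \<in> {1..<p}" for j
      using that pow_eq_id[OF xc] ord[OF x(1)] by (auto dest: dvd_imp_le)
    have "X = (\<lambda>j. x [^] j) ` {1..<p}"
    proof (intro equalityI subsetI)
      fix y assume "y \<in> X"
      then obtain j :: nat where y: "y \<in> W" "y = x [^] j" using x by (auto simp: r_def)
      have "y = x [^] (j mod p)"
        unfolding y by (rule pow_cong[OF xc, of p]) (use root[OF x(1)] in \<open>auto simp: cong_def\<close>)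
      moreover have "j mod p \<noteq> 0" using root[OF y(1)] calculation by (metis nat_pow_0)
      moreover have "j mod p < p" using p prime_gt_0_nat by simp
      ultimately show "y \<in> (\<lambda>j. x [^] j) ` {1..<p}" by simp
    next
      fix y assume "y \<in> (\<lambda>j. x [^] j) ` {1..<p}"
      then show "y \<in> X" using x closed[OF x(1)] ne by (auto simp: r_def)
    qed
    moreover have "inj_on (\<lambda>j::nat. x [^] j) {1..<p}"
    proof (rule inj_onI)
      fix i j assume ij: "i \<in> {1..<p}" "j \<in> {1..<p}" "x [^] i = x [^] j"
      then have "int p dvd int j - int i"
        using int_pow_eq[OF xc, of "int i" "int j"] ord[OF x(1)] by (simp add: int_pow_int)
      then have "int j mod int p = int i mod int p" by (simp add: mod_eq_dvd_iff)
      then show "i = j" using ij by simp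
    qed
    ultimately show ?thesis by (simp add: card_image)
  qed
  ultimately show ?thesis using equiv_imp_dvd_card finite_subset[OF W fin] by blast
qed

lemma squarefree_imp_not_dvd:
  fixes p m :: nat
  assumes "squarefree (p * m)" "prime p"
  shows "\<not> p dvd m"
proof
  assume "p dvd m"
  then have "p\<^sup>2 dvd p * m" by (simp add: power2_eq_square)
  with assms(1) have "p dvd 1" by (rule squarefreeD)
  with assms(2) show False by simp
qed

text \<open>Passing from \<open>a p\<close> to \<open>a\<close>: the number \<open>c\<close> of solutions of \<open>x\<^sup>a = 1\<close> is some \<open>a t\<close> by Frobenius, and
  \<open>a p - c\<close> is a positive multiple of \<open>p - 1\<close>, which is coprime to \<open>a\<close>; hence \<open>t = 1\<close>.\<close>

lemma (in group) card_roots_squarefree: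
  assumes fin: "finite (carrier G)" and sqf: "squarefree (order G)"
  shows "\<lbrakk>order G = a * b; \<And>p q. \<lbrakk>prime p; prime q; p dvd b; q dvd a\<rbrakk> \<Longrightarrow> p < q\<rbrakk>
    \<Longrightarrow> card {x \<in> carrier G. x [^] a = \<one>} = a"
proof (induction b arbitrary: a rule: less_induct)
  case (less b)
  have n0: "order G > 0" using fin order_gt_0_iff_finite by blast
  then have ab0: "a > 0" "b > 0" using less(2) by auto
  show ?case
  proof (cases "b = 1")
    case True
    then have "x [^] a = \<one>" if "x \<in> carrier G" for x
      using pow_order_eq_1[OF that] less(2) by simp
    then have "{x \<in> carrier G. x [^] a = \<one>} = carrier G" by blast
    then show ?thesis using less(2) True by (simp add: order_def)
  next
    case False
    \<comment> \<open>Moving the largest prime of \<open>b\<close> over to \<open>a\<close> keeps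
      the primes of the cofactor \<open>b'\<close> below all primes of \<open>a * p\<close>;
      squarefreeness keeps \<open>p\<close> itself out of \<open>b'\<close>.\<close>
    define p where "p = Max (prime_factors b)"
    have "prime_factors b \<noteq> {}" using False ab0 prime_factor_nat[of b] by (auto simp: prime_factors_dvd)
    then have "p \<in> prime_factors b" unfolding p_def by (intro Max_in) auto
    then have p: "prime p" "p dvd b" by (auto simp: prime_factors_dvd)
    have pmax: "r \<le> p" if "prime r" "r dvd b" for r
      using that ab0 unfolding p_def by (intro Max_ge) (auto simp: prime_factors_dvd)
    obtain b' where b': "b = p * b'" using p(2) by auto
    have p1: "p > 1" using p(1) by (rule prime_gt_1_nat)
    have "\<not> p dvd a * b'"
      by (rule squarefree_imp_not_dvd) (use p(1) sqf less(2) b' in \<open>simp_all add: ac_simps\<close>)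
    then have npb': "\<not> p dvd b'" by auto
    have cop: "coprime a b"
    proof (rule ccontr)
      assume "\<not> coprime a b"
      then obtain r where "prime r" "r dvd a" "r dvd b"
        using prime_factor_nat[of "gcd a b"] by (auto simp: coprime_iff_gcd_eq_1)
      then show False using less(3) by blast
    qed
    have IH: "card {x \<in> carrier G. x [^] (a * p) = \<one>} = a * p"
    proof (rule less(1))
      show "b' < b" using b' p1 ab0 by (cases "b' = 0") auto
      show "order G = a * p * b'" using less(2) b' by simp
      fix r q assume rq: "prime r" "prime q" "r dvd b'" "q dvd a * p"
      have "r \<noteq> p" using rq npb' by auto
      moreover have "r \<le> p" using pmax rq b' by auto
      ultimately have "r < p" by simp
      moreover have "q dvd a \<or> q = p" using rq p(1) by (metis prime_dvd_mult_iff primes_dvd_imp_eq)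
      moreover have "q dvd a \<Longrightarrow> p < q" using less(3) p rq by blast
      ultimately show "r < q" by auto
    qed
    define c where "c = card {x \<in> carrier G. x [^] a = \<one>}"
    have "gcd a (order G) = a" using less(2) by simp
    then have "a dvd c" using frobenius_roots[OF cop is_group fin] less(2) by (simp add: c_def)
    then obtain t where t: "c = a * t" by auto
    have "\<one> \<in> {x \<in> carrier G. x [^] a = \<one>}" by simp
    then have "c > 0" unfolding c_def using fin by (intro card_gt_0_iff[THEN iffD2]) auto
    then have t0: "t > 0" using t by simp
    \<comment> \<open>The trivial root is split off: over all \<open>u\<close> these ones add up to
      \<open>c\<close>, and what remains is the multiple \<open>K\<close> of
      \<open>p - 1\<close>.\<close>
    define W where "W u = {v \<in> carrier G. v [^] p = \<one> \<and> v \<noteq> \<one> \<and> u \<otimes> v = v \<otimes> u}" for u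
    have W: "card {v \<in> carrier G. v [^] p = \<one> \<and> u \<otimes> v = v \<otimes> u} = 1 + card (W u)"
      if "u \<in> carrier G" for u
    proof -
      have "{v \<in> carrier G. v [^] p = \<one> \<and> u \<otimes> v = v \<otimes> u} = insert \<one> (W u)"
        using that by (auto simp: W_def)
      moreover have "finite (W u)" "\<one> \<notin> W u" using fin by (auto simp: W_def)
      ultimately show ?thesis by simp
    qed
    have Wdvd: "p - 1 dvd card (W u)" if u: "u \<in> carrier G" for u
    proof (rule dvd_card_prime_order_elements[OF fin p(1)])
      fix x and j :: nat assume x: "x \<in> W u" "x [^] j \<noteq> \<one>"
      then have xc: "x \<in> carrier G" "x [^] p = \<one>" "x \<otimes> u = u \<otimes> x" by (auto simp: W_def)
      have "(x [^] j) [^] p = (x [^] p) [^] j" using xc(1) by (simp add: nat_pow_pow mult.commute)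
      moreover have "x [^] j \<otimes> u = u \<otimes> x [^] j" using group_commutes_pow[OF xc(3) xc(1) u] .
      ultimately show "x [^] j \<in> W u" using x(2) xc by (simp add: W_def)
    qed (auto simp: W_def)
    define K where "K = (\<Sum>u | u \<in> carrier G \<and> u [^] a = \<one>. card (W u))"
    have "coprime a p" using cop b' by simp
    then have "a * p = (\<Sum>u | u \<in> carrier G \<and> u [^] a = \<one>.
        card {v \<in> carrier G. v [^] p = \<one> \<and> u \<otimes> v = v \<otimes> u})"
      using card_roots_coprime_mult[OF fin, of a p] IH by argo
    also have "\<dots> = (\<Sum>u | u \<in> carrier G \<and> u [^] a = \<one>. 1 + card (W u))"
      by (intro sum.cong refl W) simp
    also have "\<dots> = c + K" unfolding sum.distrib c_def K_def by simp
    finally have eq: "a * p = a * t + K" using t by simp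
    \<comment> \<open>Cauchy makes \<open>K\<close> positive, hence \<open>t < p\<close>. Then
      \<open>p - t\<close> is nonzero, so its divisor \<open>p - 1\<close> cannot exceed it.\<close>
    have "p dvd order G" using less(2) b' by simp
    then obtain x where x: "x \<in> carrier G" "x \<noteq> \<one>" "x [^] p = \<one>" by (rule cauchy[OF fin p(1)])
    have "K > 0"
    proof -
      have "x \<in> W \<one>" using x by (simp add: W_def)
      moreover have "finite (W \<one>)" using fin by (simp add: W_def)
      ultimately have "card (W \<one>) > 0" by (auto simp: card_gt_0_iff)
      moreover have "card (W \<one>) \<le> K" unfolding K_def using fin by (intro member_le_sum) auto
      ultimately show ?thesis by simp
    qed
    then have "a * t < a * p" using eq by simp
    then have tp: "t < p" by simp
    have "p - 1 dvd K" unfolding K_def using Wdvd by (intro dvd_sum) auto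
    moreover have "K = a * (p - t)" using eq by (simp add: diff_mult_distrib2)
    \<comment> \<open>Primes of \<open>p - 1\<close> are below \<open>p\<close>, primes of
      \<open>a\<close> above it.\<close>
    moreover have "coprime (p - 1) a"
    proof (rule ccontr)
      assume "\<not> coprime (p - 1) a"
      then obtain r where r: "prime r" "r dvd p - 1" "r dvd a"
        using prime_factor_nat[of "gcd (p - 1) a"] by (auto simp: coprime_iff_gcd_eq_1)
      then have "r \<le> p - 1" using p1 by (intro dvd_imp_le) auto
      moreover have "p < r" using less(3) p r by blast
      ultimately show False by simp
    qed
    ultimately have "p - 1 dvd p - t" by (simp add: coprime_dvd_mult_right_iff)
    then have "p - 1 \<le> p - t" using tp by (intro dvd_imp_le) auto
    then have "t = 1" using t0 tp by simp
    then show ?thesis using t c_def by simp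
  qed
qed

text \<open>For the largest prime \<open>q\<close>, the equation \<open>x [^] q = \<one>\<close> has
  exactly \<open>q\<close> solutions. A subgroup of order \<open>q\<close> is therefore the whole
  solution set, which conjugation preserves.\<close>

lemma (in group) normal_subgroup_prime_order:
  assumes fin: "finite (carrier G)" and sqf: "squarefree (order G)" and "order G > 1"
  obtains Q where "Q \<lhd> G" "prime (card Q)"
proof -
  define n where "n = order G"
  define q where "q = Max (prime_factors n)"
  have "prime_factors n \<noteq> {}" using assms(3) prime_factor_nat[of n] by (auto simp: n_def prime_factors_dvd)
  then have "q \<in> prime_factors n" unfolding q_def by (intro Max_in) auto
  then have q: "prime q" "q dvd n" by (auto simp: prime_factors_dvd)
  then obtain m where m: "n = q * m" by auto
  have "card {x \<in> carrier G. x [^] q = \<one>} = q"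
  proof (rule card_roots_squarefree[OF fin sqf])
    show "order G = q * m" using m n_def by simp
    fix r s assume rs: "prime r" "prime s" "r dvd m" "s dvd q"
    have "s = q" using rs q(1) by (metis primes_dvd_imp_eq)
    have "r \<le> q" unfolding q_def using rs m assms(3) by (intro Max_ge) (auto simp: n_def in_prime_factors_iff intro!: gr0I)
    moreover have "r \<noteq> q"
      using squarefree_imp_not_dvd[of q m] q(1) sqf m n_def rs(3) by auto
    ultimately show "r < s" using \<open>s = q\<close> by simp
  qed
  moreover obtain Q where Q: "subgroup Q G" "card Q = q"
    using sylow_thm[OF q(1) is_group _ fin, of 1 m] m n_def by auto
  moreover have "Q \<subseteq> {x \<in> carrier G. x [^] q = \<one>}"
    using pow_card_subgroup_eq_one[OF Q(1)] Q subgroup.subset by blast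
  ultimately have roots: "Q = {x \<in> carrier G. x [^] q = \<one>}" using fin by (intro card_subset_eq) auto
  have "Q \<lhd> G" unfolding normal_inv_iff using Q(1) by (auto simp: roots conj_pow)
  then show ?thesis using that Q q by blast
qed

section \<open>Commutators and normal subgroups\<close>

text \<open>The convention is that of \<open>derived_set\<close>, so the values are literally the
  generators of the derived subgroup.\<close>

definition commutator :: "('a, 'b) monoid_scheme \<Rightarrow> 'a \<Rightarrow> 'a \<Rightarrow> 'a" where
  "commutator G x y = x \<otimes>\<^bsub>G\<^esub> y \<otimes>\<^bsub>G\<^esub> inv\<^bsub>G\<^esub> x \<otimes>\<^bsub>G\<^esub> inv\<^bsub>G\<^esub> y"

lemma (in group) commutator_closed:
  "\<lbrakk>x \<in> carrier G; y \<in> carrier G\<rbrakk> \<Longrightarrow> commutator G x y \<in> carrier G"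
  by (simp add: commutator_def)

lemma (in group) commutator_mult:
  assumes "x \<in> carrier G" "y \<in> carrier G"
  shows "commutator G x y \<otimes> (y \<otimes> x) = x \<otimes> y"
proof -
  have "inv x \<otimes> (inv y \<otimes> (y \<otimes> x)) = \<one>" using assms by (simp flip: m_assoc[of "inv y"])
  then show ?thesis using assms by (simp add: commutator_def m_assoc)
qed

lemma (in group) commutator_eq_one_iff:
  assumes "x \<in> carrier G" "y \<in> carrier G"
  shows "commutator G x y = \<one> \<longleftrightarrow> x \<otimes> y = y \<otimes> x"
  using commutator_mult[OF assms] assms commutator_closed[OF assms]
  by (metis l_one m_closed r_cancel_one')

text \<open>A nontrivial element of \<open>Q\<close> has order dividing a prime, so it generates
  \<open>Q\<close>. Natural exponents suffice by finiteness, and they are what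
  \<open>conj_pow\<close> handles.\<close>

lemma (in group) prime_subgroup_eq_powers:
  assumes fin: "finite (carrier G)" and Q: "subgroup Q G" and q: "prime (card Q)"
  obtains c where "c \<in> Q" "Q = {c [^] k | k. k \<in> (UNIV :: nat set)}"
proof -
  have finQ: "finite Q" using fin subgroup.subset[OF Q] finite_subset by blast
  have "\<not> Q \<subseteq> {\<one>}" using card_mono[of "{\<one>}" Q] prime_gt_1_nat[OF q] by auto
  then obtain c where c: "c \<in> Q" "c \<noteq> \<one>" by blast
  have cc: "c \<in> carrier G" using c Q subgroup.mem_carrier by metis
  have "ord c dvd card Q" using pow_card_subgroup_eq_one[OF Q c(1)] pow_eq_id[OF cc] by blast
  moreover have "ord c \<noteq> 1" using ord_eq_1[OF cc] c by blast
  ultimately have "card (generate G {c}) = card Q" using q generate_pow_card[OF cc] by (metis prime_nat_iff)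
  moreover have "generate G {c} \<subseteq> Q" using generate_subgroup_incl[of "{c}" Q] c Q by simp
  ultimately have "generate G {c} = Q" using finQ by (intro card_subset_eq) auto
  then show ?thesis using that[OF c(1)] generate_pow_on_finite_carrier[OF fin cc] by simp
qed

text \<open>Each group element acts on the cyclic group \<open>Q\<close> by conjugation as a power
  map, with one exponent for all of \<open>Q\<close>. Power maps commute, so
  \<open>x \<otimes> y\<close> and \<open>y \<otimes> x\<close> act alike and the commutator acts
  trivially.\<close>

lemma (in group) commutator_centralizes_prime_normal:
  assumes fin: "finite (carrier G)" and Q: "Q \<lhd> G" and q: "prime (card Q)"
    and x: "x \<in> carrier G" and y: "y \<in> carrier G" and c: "c \<in> Q"
  shows "commutator G x y \<otimes> c = c \<otimes> commutator G x y"
proof -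
  interpret Q: normal Q G by fact
  obtain e where e: "e \<in> Q" "Q = {e [^] k | k. k \<in> (UNIV :: nat set)}"
    using prime_subgroup_eq_powers[OF fin Q.subgroup_axioms q] .
  have pow: "\<exists>i::nat. \<forall>c\<in>Q. g \<otimes> c \<otimes> inv g = c [^] i" if g: "g \<in> carrier G" for g
  proof -
    have "g \<otimes> e \<otimes> inv g \<in> Q" using Q.inv_op_closed2 g e(1) by blast
    then obtain i :: nat where i: "g \<otimes> e \<otimes> inv g = e [^] i" using e(2) by auto
    have "g \<otimes> c \<otimes> inv g = c [^] i" if "c \<in> Q" for c
    proof -
      obtain k :: nat where k: "c = e [^] k" using e(2) \<open>c \<in> Q\<close> by auto
      have ec: "e \<in> carrier G" using e(1) by simp
      have "g \<otimes> c \<otimes> inv g = (g \<otimes> e \<otimes> inv g) [^] k" using conj_pow[OF g ec] k by simp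
      also have "\<dots> = c [^] i" unfolding i k using ec by (simp add: nat_pow_pow mult.commute)
      finally show ?thesis .
    qed
    then show ?thesis by blast
  qed
  obtain i :: nat where i: "\<And>c. c \<in> Q \<Longrightarrow> x \<otimes> c \<otimes> inv x = c [^] i" using pow[OF x] by blast
  obtain j :: nat where j: "\<And>c. c \<in> Q \<Longrightarrow> y \<otimes> c \<otimes> inv y = c [^] j" using pow[OF y] by blast
  have xy: "x \<otimes> y \<otimes> d \<otimes> inv (x \<otimes> y) = y \<otimes> x \<otimes> d \<otimes> inv (y \<otimes> x)" if d: "d \<in> Q" for d
  proof -
    have dc: "d \<in> carrier G" using d by simp
    have powQ: "d [^] k \<in> Q" for k :: nat
      using d by (induction k) auto
    have "x \<otimes> y \<otimes> d \<otimes> inv (x \<otimes> y) = x \<otimes> (y \<otimes> d \<otimes> inv y) \<otimes> inv x"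
      using x y dc by (simp add: m_assoc inv_mult_group)
    also have "\<dots> = d [^] (j * i)" using i[OF powQ] j[OF d] dc by (simp add: nat_pow_pow)
    also have "\<dots> = d [^] (i * j)" by (simp add: mult.commute)
    also have "\<dots> = y \<otimes> (x \<otimes> d \<otimes> inv x) \<otimes> inv y" using j[OF powQ] i[OF d] dc by (simp add: nat_pow_pow)
    also have "\<dots> = y \<otimes> x \<otimes> d \<otimes> inv (y \<otimes> x)" using x y dc by (simp add: m_assoc inv_mult_group)
    finally show ?thesis .
  qed
  \<comment> \<open>Now \<open>a \<otimes> v\<close> is \<open>x \<otimes> y\<close>. As
    \<open>c\<close> is the conjugate of \<open>d\<close> by \<open>v\<close>, conjugating
    \<open>c\<close> by \<open>a\<close> means conjugating \<open>d\<close> by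
    \<open>x \<otimes> y\<close>, which by \<open>xy\<close> has the same effect as
    \<open>v\<close>.\<close>
  define v where "v = y \<otimes> x"
  define a where "a = commutator G x y"
  have v: "v \<in> carrier G" and a: "a \<in> carrier G" and av: "a \<otimes> v = x \<otimes> y"
    using x y commutator_closed commutator_mult by (auto simp: v_def a_def)
  define d where "d = inv v \<otimes> c \<otimes> v"
  have d: "d \<in> Q" unfolding d_def using Q.inv_op_closed1[OF v c] .
  have cc: "c \<in> carrier G" and dc: "d \<in> carrier G" using c d by auto
  have c_eq: "v \<otimes> d \<otimes> inv v = c"
    using conj_conj_inv[of "inv v" c] v cc by (simp add: d_def)
  have "a \<otimes> c \<otimes> inv a = a \<otimes> v \<otimes> d \<otimes> inv (a \<otimes> v)"
    unfolding c_eq[symmetric] using a v dc by (simp add: m_assoc inv_mult_group)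
  also have "\<dots> = c" using xy[OF d] av c_eq by (simp add: v_def)
  finally show ?thesis using conj_eq_iff_commute[OF a cc] by (simp add: a_def)
qed

lemma (in group) commutators_commute_mod_prime_normal:
  assumes fin: "finite (carrier G)" and Q: "Q \<lhd> G" and q: "prime (card Q)"
    and cop: "coprime (card Q) (order G div card Q)"
    and mem: "x \<in> carrier G" "y \<in> carrier G" "z \<in> carrier G" "w \<in> carrier G"
    and inQ: "commutator G (commutator G x y) (commutator G z w) \<in> Q"
  shows "commutator G (commutator G x y) (commutator G z w) = \<one>"
proof -
  interpret Q: normal Q G by fact
  define a where "a = commutator G x y"
  define b where "b = commutator G z w"
  define c where "c = commutator G a b"
  have a: "a \<in> carrier G" and b: "b \<in> carrier G" and cQ: "c \<in> Q"
    using mem commutator_closed inQ by (auto simp: a_def b_def c_def)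
  have cc: "c \<in> carrier G" using cQ by simp
  have comm: "a \<otimes> d = d \<otimes> a" "b \<otimes> d = d \<otimes> b" if "d \<in> Q" for d
    unfolding a_def b_def using commutator_centralizes_prime_normal[OF fin Q q _ _ that] mem by auto
  \<comment> \<open>The conjugate of \<open>a [^] n\<close> by \<open>b\<close> is computed twice.
    It is \<open>a [^] n\<close> itself, which lies in \<open>Q\<close> and so commutes with
    \<open>b\<close>. But \<open>b\<close> also takes \<open>a\<close> to
    \<open>inv c \<otimes> a\<close>, whose power is \<open>inv c [^] n \<otimes> a [^] n\<close>
    because \<open>a\<close> commutes with \<open>inv c\<close>.\<close>
  define n where "n = order G div card Q"
  have n: "n * card Q = order G" unfolding n_def using lagrange[OF Q.subgroup_axioms]
    by (metis dvd_div_mult_self dvd_triv_right)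
  have "card (rcosets Q) = n"
    using lagrange[OF Q.subgroup_axioms] n prime_gt_0_nat[OF q] by (metis mult_cancel2 neq0_conv)
  then have "order (G Mod Q) = n" by (simp add: order_def FactGroup_def)
  moreover have "Q #> a \<in> carrier (G Mod Q)" using a by (simp add: carrier_FactGroup)
  ultimately have "(Q #> a) [^]\<^bsub>G Mod Q\<^esub> n = \<one>\<^bsub>G Mod Q\<^esub>"
    using group.pow_order_eq_1[OF Q.factorgroup_is_group] by blast
  then have "Q #> (a [^] n) = Q" using Q.FactGroup_pow[OF a] by simp
  then have anQ: "a [^] n \<in> Q" using rcos_self[OF nat_pow_closed[OF a, of n] Q.subgroup_axioms] by simp
  have "b \<otimes> a \<otimes> inv b = inv c \<otimes> a"
  proof -
    have "c \<otimes> (b \<otimes> a) = a \<otimes> b" unfolding c_def by (rule commutator_mult[OF a b])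
    then have "inv c \<otimes> (a \<otimes> b) = b \<otimes> a" using a b cc by (metis inv_solve_left m_closed)
    then have "b \<otimes> a \<otimes> inv b = inv c \<otimes> (a \<otimes> b) \<otimes> inv b" by simp
    then show ?thesis using a b cc by (simp add: m_assoc)
  qed
  then have "b \<otimes> a [^] n \<otimes> inv b = (inv c \<otimes> a) [^] n" using conj_pow[OF b a] by simp
  also have "\<dots> = inv c [^] n \<otimes> a [^] n"
    using pow_mult_distrib[of "inv c" a] comm(1)[of "inv c"] cQ cc a by simp
  also have "b \<otimes> a [^] n \<otimes> inv b = a [^] n"
    using comm(2)[OF anQ] conj_eq_iff_commute[OF b nat_pow_closed[OF a]] by blast
  finally have "inv c [^] n = \<one>" using a cc by (metis inv_closed l_cancel_one' nat_pow_closed r_cancel_one')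
  then have "ord c dvd n" using cc by (metis inv_closed ord_inv pow_eq_id)
  moreover have "ord c dvd card Q"
    using pow_card_subgroup_eq_one[OF Q.subgroup_axioms cQ] pow_eq_id[OF cc] by blast
  ultimately have "ord c = 1" using cop unfolding n_def
    by (metis coprime_common_divisor nat_dvd_1_iff_1)
  then show ?thesis using ord_eq_1[OF cc] by (simp add: c_def a_def b_def)
qed

lemma (in group_hom) hom_commutator:
  "\<lbrakk>x \<in> carrier G; y \<in> carrier G\<rbrakk> \<Longrightarrow> h (commutator G x y) = commutator H (h x) (h y)"
  by (simp add: commutator_def)

lemma (in group_hom) normal_vimage:
  assumes "N \<lhd> H"
  shows "{x \<in> carrier G. h x \<in> N} \<lhd> G"
proof -
  interpret N: normal N H by fact
  show ?thesis
    unfolding G.normal_inv_iff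
  proof (intro conjI ballI)
    show "subgroup {x \<in> carrier G. h x \<in> N} G"
      by (rule G.subgroupI) (use N.one_closed in \<open>auto intro!: exI[of _ \<one>]\<close>)
    fix x y assume "x \<in> carrier G" "y \<in> {x \<in> carrier G. h x \<in> N}"
    then show "x \<otimes> y \<otimes> inv x \<in> {x \<in> carrier G. h x \<in> N}"
      using N.inv_op_closed2[of "h x" "h y"] by simp
  qed
qed

text \<open>The induction runs over quotients of a fixed group, since the induction hypothesis cannot be
  applied to \<open>G Mod N\<close>, whose elements have a different type.\<close>

lemma (in group) commutators_commute_mod_normal:
  assumes fin: "finite (carrier G)"
  shows "\<lbrakk>N \<lhd> G; squarefree (order (G Mod N));
      x \<in> carrier G; y \<in> carrier G; z \<in> carrier G; w \<in> carrier G\<rbrakk>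
    \<Longrightarrow> commutator G (commutator G x y) (commutator G z w) \<in> N"
proof (induction "order (G Mod N)" arbitrary: N rule: less_induct)
  case less
  interpret N: normal N G by fact
  define h where "h = (\<lambda>g. N #> g)"
  have ord_mod: "order (G Mod K) * card K = order G" if "K \<lhd> G" for K
    using lagrange[OF normal_imp_subgroup[OF that]] by (simp add: order_def FactGroup_def)
  interpret h: group_hom G "G Mod N" h
    unfolding h_def by (intro group_hom.intro group_hom_axioms.intro is_group
      N.factorgroup_is_group N.r_coset_hom_Mod)
  have h_one: "g \<in> N" if "g \<in> carrier G" "h g = N" for g
    using that rcos_self[OF _ N.subgroup_axioms] by (auto simp: h_def)
  have finM: "finite (carrier (G Mod N))" using fin by (simp add: carrier_FactGroup)
  define a where "a = commutator G x y"
  define b where "b = commutator G z w"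
  have ab: "a \<in> carrier G" "b \<in> carrier G" "commutator G a b \<in> carrier G"
    using less(4-7) commutator_closed by (auto simp: a_def b_def)
  have "h (commutator G a b) = N"
  proof (cases "order (G Mod N) > 1")
    case False
    moreover have "order (G Mod N) > 0" using finM h.H.order_gt_0_iff_finite by blast
    ultimately have "card (carrier (G Mod N)) = 1" by (simp add: order_def)
    then obtain c where "carrier (G Mod N) = {c}" by (auto simp: card_1_singleton_iff)
    then show ?thesis using h.hom_closed[OF ab(3)] h.H.one_closed by simp
  next
    case True
    obtain Q where Q: "Q \<lhd> G Mod N" "prime (card Q)"
      using h.H.normal_subgroup_prime_order[OF finM less(3) True] .
    interpret Q: normal Q "G Mod N" by fact
    \<comment> \<open>The preimage \<open>M\<close> of \<open>Q\<close> strictly contains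
      \<open>N\<close>, so the quotient by \<open>M\<close> is smaller. The induction hypothesis
      puts the double commutator in \<open>M\<close>, hence its image in \<open>Q\<close>.\<close>
    define M where "M = {g \<in> carrier G. h g \<in> Q}"
    have M: "M \<lhd> G" unfolding M_def by (rule h.normal_vimage[OF Q(1)])
    interpret M: normal M G by fact
    have NM: "N \<subseteq> M"
    proof
      fix g assume g: "g \<in> N"
      have "h g = \<one>\<^bsub>G Mod N\<^esub>" unfolding h_def one_FactGroup by (rule N.rcos_const[OF is_group g])
      then have "h g \<in> Q" using Q.one_closed by simp
      then show "g \<in> M" unfolding M_def using N.mem_carrier[OF g] by blast
    qed
    have "\<not> Q \<subseteq> {N}" using card_mono[of "{N}" Q] prime_gt_1_nat[OF Q(2)] by auto
    then obtain c where c: "c \<in> Q" "c \<noteq> N" by blast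
    then have "c \<in> carrier (G Mod N)" using Q.subset by blast
    then obtain g where g: "g \<in> carrier G" "c = h g"
      unfolding carrier_FactGroup h_def by blast
    then have "g \<in> M" unfolding M_def using c(1) by blast
    moreover have "g \<notin> N"
      using N.rcos_const[OF is_group, of g] g(2) c(2) unfolding h_def by blast
    ultimately have "N \<subset> M" using NM by blast
    then have lt: "card N < card M" using fin M.subset finite_subset psubset_card_mono by metis
    \<comment> \<open>Comparing orders takes the place of the third isomorphism theorem: with
      \<open>t\<close> the index of \<open>N\<close> in \<open>M\<close>, the order of
      \<open>G Mod N\<close> is \<open>t\<close> times that of \<open>G Mod M\<close>, which is thus
      smaller and still squarefree.\<close>
    have "subgroup N (G\<lparr>carrier := M\<rparr>)"
      using subgroup_incl[OF N.subgroup_axioms M.subgroup_axioms NM] .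
    then have "card (rcosets\<^bsub>G\<lparr>carrier := M\<rparr>\<^esub> N) * card N = card M"
      using group.lagrange[OF subgroup_imp_group[OF M.subgroup_axioms]] by (fastforce simp: order_def)
    then obtain t where t: "card M = t * card N" by metis
    then have "t > 1" using lt by (cases "t \<le> 1") (auto simp: le_Suc_eq)
    have "card N > 0" using fin N.subset finite_subset N.one_closed card_gt_0_iff by blast
    moreover have "order (G Mod N) * card N = order (G Mod M) * t * card N"
      using ord_mod[OF less(2)] ord_mod[OF M] t by simp
    ultimately have idx: "order (G Mod N) = order (G Mod M) * t" by simp
    moreover have "order (G Mod M) > 0" using idx True by (cases "order (G Mod M)") auto
    ultimately have idx_less: "order (G Mod M) < order (G Mod N)" using \<open>t > 1\<close> by simp
    have sqfM: "squarefree (order (G Mod M))" using less(3) idx squarefree_multD by metis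
    have "commutator G a b \<in> M"
      unfolding a_def b_def by (rule less(1)[OF idx_less M sqfM less(4-7)])
    then have hQ: "h (commutator G a b) \<in> Q" unfolding M_def by blast
    have cop: "coprime (card Q) (order (G Mod N) div card Q)"
    proof -
      have "card (rcosets\<^bsub>G Mod N\<^esub> Q) * card Q = order (G Mod N)"
        using h.H.lagrange[OF Q.subgroup_axioms] .
      then obtain m where m: "order (G Mod N) = card Q * m" by (metis mult.commute)
      have "\<not> card Q dvd m"
        using squarefree_imp_not_dvd[of "card Q" m] less(3) Q(2) m by simp
      then have "coprime (card Q) m" using Q(2) by (metis prime_imp_coprime)
      then show ?thesis using m prime_gt_0_nat[OF Q(2)] by simp
    qed
    have "h (commutator G a b) = commutator (G Mod N)
        (commutator (G Mod N) (h x) (h y)) (commutator (G Mod N) (h z) (h w))"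
      using ab(1,2) less(4-7) unfolding a_def b_def by (simp only: h.hom_commutator)
    moreover have "h x \<in> carrier (G Mod N)" "h y \<in> carrier (G Mod N)"
        "h z \<in> carrier (G Mod N)" "h w \<in> carrier (G Mod N)"
      using less(4-7) by (simp_all only: h.hom_closed)
    ultimately have "h (commutator G a b) = \<one>\<^bsub>G Mod N\<^esub>"
      using h.H.commutators_commute_mod_prime_normal[OF finM Q cop] hQ by metis
    then show ?thesis by (simp only: one_FactGroup)
  qed
  then show ?case using h_one[OF ab(3)] by (simp add: a_def b_def)
qed

section \<open>The class number of a metabelian group\<close>

lemma (in group) generate_commute_left:
  assumes "S \<subseteq> carrier G" "y \<in> carrier G" and comm: "\<And>s. s \<in> S \<Longrightarrow> s \<otimes> y = y \<otimes> s"
    and "x \<in> generate G S"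
  shows "x \<otimes> y = y \<otimes> x"
  using assms(4)
proof induction
  case (inv s)
  then show ?case using inv_comm_commute[of s y] comm[OF inv] assms(1,2) by auto
next
  case (eng s t)
  have "s \<in> carrier G" "t \<in> carrier G" using generate_in_carrier[OF assms(1)] eng by auto
  then have "s \<otimes> t \<otimes> y = s \<otimes> (y \<otimes> t)" using eng(4) assms(2) by (simp add: m_assoc)
  also have "\<dots> = (s \<otimes> y) \<otimes> t" using \<open>s \<in> carrier G\<close> \<open>t \<in> carrier G\<close> assms(2) by (simp add: m_assoc)
  also have "\<dots> = y \<otimes> (s \<otimes> t)" unfolding eng(3) using \<open>s \<in> carrier G\<close> \<open>t \<in> carrier G\<close> assms(2) by (simp add: m_assoc)
  finally show ?case .
qed (use assms comm in auto)

text \<open>Two passes of \<open>generate_commute_left\<close>: first every generator commutes with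
  the generated \<open>y\<close>, then so does the generated \<open>x\<close>.\<close>

lemma (in group) generate_commute:
  assumes S: "S \<subseteq> carrier G" and comm: "\<And>s t. \<lbrakk>s \<in> S; t \<in> S\<rbrakk> \<Longrightarrow> s \<otimes> t = t \<otimes> s"
    and x: "x \<in> generate G S" and y: "y \<in> generate G S"
  shows "x \<otimes> y = y \<otimes> x"
proof -
  have "s \<otimes> y = y \<otimes> s" if "s \<in> S" for s
    using generate_commute_left[OF S _ _ y, of s] comm that S by (metis subsetD)
  then show ?thesis
    using generate_commute_left[OF S _ _ x, of y] generate_in_carrier[OF S y] by blast
qed

lemma (in group) order_le_of_metabelian:
  assumes fin: "finite (carrier G)"
    and comm: "\<And>x y z w. \<lbrakk>x \<in> carrier G; y \<in> carrier G; z \<in> carrier G; w \<in> carrier G\<rbrakk>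
      \<Longrightarrow> commutator G x y \<otimes> commutator G z w = commutator G z w \<otimes> commutator G x y"
  shows "order G \<le> num_conj_classes G ^ 3"
proof -
  define D where "D = derived G (carrier G)"
  have der: "derived_set G (carrier G) = {commutator G x y | x y. x \<in> carrier G \<and> y \<in> carrier G}"
    by (auto simp: commutator_def)
  have D_gen: "D = generate G (derived_set G (carrier G))" by (simp add: D_def derived_def)
  have abel: "x \<otimes> y = y \<otimes> x" if "x \<in> D" "y \<in> D" for x y
  proof (rule generate_commute[OF derived_set_in_carrier[OF subset_refl] _ that[unfolded D_gen]])
    show "s \<otimes> t = t \<otimes> s" if "s \<in> derived_set G (carrier G)" "t \<in> derived_set G (carrier G)" for s t
      using that comm unfolding der by blast
  qed
  have comm_in: "commutator G x y \<in> D" if "x \<in> carrier G" "y \<in> carrier G" for x y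
    unfolding D_gen der using that by (intro generate.incl) blast
  have D: "D \<lhd> G" unfolding D_def by (rule derived_self_is_normal)
  interpret D: normal D G by fact
  define n where "n = card (rcosets D)"
  define k where "k = num_conj_classes G"
  have n: "n * card D = order G" unfolding n_def by (rule lagrange[OF D.subgroup_axioms])
  have D0: "card D > 0" using fin D.subset finite_subset D.one_closed card_gt_0_iff by blast
  define \<phi> where "\<phi> = (\<lambda>g. \<lambda>h \<in> carrier G. g \<otimes> h \<otimes> inv g)"
  interpret conj: group_action G "carrier G" \<phi>
    unfolding \<phi>_def by (rule action_by_conjugation)
  have cls: "conj_classes G = orbit G \<phi> ` carrier G"
    by (auto simp: conj_classes_def orbits_def \<phi>_def)
  then have fin_cls: "finite (conj_classes G)" using fin by simp
  have "n \<le> k"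
  proof -
    \<comment> \<open>A class is sent to the coset of a chosen member. Any choice works: a conjugate
      of \<open>x\<close> is a commutator times \<open>x\<close>, so it stays in
      \<open>D #> x\<close>, and every coset is reached.\<close>
    have "rcosets D \<subseteq> (\<lambda>A. D #> (SOME y. y \<in> A)) ` conj_classes G"
    proof
      fix c assume "c \<in> rcosets D"
      then obtain x where x: "x \<in> carrier G" "c = D #> x" by (auto simp: RCOSETS_def)
      define y where "y = (SOME y. y \<in> orbit G \<phi> x)"
      have "y \<in> orbit G \<phi> x" unfolding y_def using conj.orbit_refl[OF x(1)] by (rule someI)
      then obtain g where g: "g \<in> carrier G" "y = g \<otimes> x \<otimes> inv g"
        using x(1) by (auto simp: orbit_def \<phi>_def)
      have "y = commutator G g x \<otimes> x" using g x by (simp add: commutator_def m_assoc)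
      then have "y \<in> D #> x" using comm_in[OF g(1) x(1)] by (auto simp: r_coset_def)
      then have "c = D #> y" using repr_independence[OF _ x(1) D.subgroup_axioms] x by blast
      then show "c \<in> (\<lambda>A. D #> (SOME y. y \<in> A)) ` conj_classes G"
        using x(1) by (auto simp: cls y_def)
    qed
    then show ?thesis unfolding n_def k_def num_conj_classes_def using fin_cls by (rule surj_card_le[rotated])
  qed
  have "card D \<le> k * n"
  proof -
    \<comment> \<open>As \<open>D\<close> is abelian, it centralizes \<open>u\<close>; so the orbit
      size, the index of the centralizer, is at most the index \<open>n\<close> of
      \<open>D\<close>.\<close>
    have orb: "card (orbit G \<phi> u) \<le> n" if u: "u \<in> D" for u
    proof -
      have uc: "u \<in> carrier G" using u by simp
      have "D \<subseteq> stabilizer G \<phi> u"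
      proof
        fix g assume g: "g \<in> D"
        then have "g \<otimes> u \<otimes> inv g = u" using conj_eq_iff_commute[OF D.mem_carrier[OF g] uc] abel[OF g u] by blast
        then show "g \<in> stabilizer G \<phi> u" using g uc by (simp add: stabilizer_def \<phi>_def)
      qed
      then have "card D \<le> card (stabilizer G \<phi> u)"
        using fin conj.stabilizer_subset finite_subset by (intro card_mono) blast+
      then have "card (orbit G \<phi> u) * card D \<le> n * card D"
        unfolding n using conj.orbit_stabilizer_theorem[OF uc] by (metis mult_le_mono2)
      then show ?thesis using D0 by simp
    qed
    have "D \<subseteq> \<Union> (orbit G \<phi> ` D)" using conj.orbit_refl by auto
    moreover have "finite (\<Union> (orbit G \<phi> ` D))"
      using fin finite_subset[OF D.subset fin] by (auto simp: orbit_def Setcompr_eq_image)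
    ultimately have "card D \<le> card (\<Union> (orbit G \<phi> ` D))" by (intro card_mono)
    also have "\<dots> \<le> sum card (orbit G \<phi> ` D)" by (rule card_Union_le_sum_card)
    also have "\<dots> \<le> card (orbit G \<phi> ` D) * n" using sum_bounded_above[of "orbit G \<phi> ` D" card n] orb by auto
    also have "card (orbit G \<phi> ` D) \<le> k"
      unfolding k_def num_conj_classes_def using fin_cls by (intro card_mono) (auto simp: cls)
    finally show ?thesis by simp
  qed
  then have "order G \<le> n * (k * n)" unfolding n[symmetric] by simp
  also have "\<dots> \<le> k * (k * k)" using \<open>n \<le> k\<close> by (intro mult_le_mono) auto
  finally show ?thesis by (simp add: k_def power3_eq_cube mult.assoc)
qed

theorem theorem3:
  fixes G :: "('a, 'b) monoid_scheme"
  assumes "group G"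
    and "finite (carrier G)"
    and "squarefree (order G)"
  shows "order G \<le> num_conj_classes G ^ 3"
proof -
  interpret group G by fact
  \<comment> \<open>With the trivial normal subgroup, the quotient has the order of \<open>G\<close>
    and membership of a double commutator means that it is the identity.\<close>
  have triv: "{\<one>\<^bsub>G\<^esub>} \<lhd> G" by (rule one_is_normal)
  have "order (G Mod {\<one>\<^bsub>G\<^esub>}) = order G"
    using card_rcosets_triv[OF assms(2)] by (simp add: order_def FactGroup_def)
  then have "commutator G (commutator G x y) (commutator G z w) = \<one>\<^bsub>G\<^esub>"
    if "x \<in> carrier G" "y \<in> carrier G" "z \<in> carrier G" "w \<in> carrier G" for x y z w
    using commutators_commute_mod_normal[OF assms(2) triv _ that] assms(3) by simp
  then show ?thesis
    using order_le_of_metabelian[OF assms(2)] commutator_eq_one_iff commutator_closed by metis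
qed

end
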